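(* Let $N,d\ge 1$ be integers, $\gamma>0$, $h>0$, $t_0\in\mathbb{R}$, $\bar\psi\in\mathbb{R}^d$, $\psi^0\in\mathbb{R}^{N\times d}$, and let $P:\mathbb{R}^d\times\mathbb{R}^d\to\mathbb{R}$ be continuously differentiable with $P(0,0)=0$ and $\|P\|_\infty:=\sup|P|<\infty$. Then the optimal control problem $Q(t_0,T,h,N,\psi^0)$ (see context) has the turnpike property with interior decay, i.e. there exist constants $\tilde C_1>0$ and $\lambda\in(0,1)$ and a strictly increasing function $\alpha:[0,\infty)\to[0,\infty)$ with $\alpha(0)=0$ such that for every $T>t_0$ for which $M:=(T-t_0)/h$ is a positive integer, every optimal state-control pair $(\psi,u)$ of $Q(t_0,T,h,N,\psi^0)$ satisfies $$\sum_{i=\lfloor(1-\lambda)M\rfloor}^{M-1} h\,\alpha\!\left(\|\psi^i-\psi^{(\sigma)}\|_N+\|u^i-u^{(\sigma)}\|_N\right)\le\tilde C_1 .$$ The constants and $\alpha$ do not depend on $T$ (they may depend on $h$ and on the other fixed data).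
   Context: For $x=(x_1,\dots,x_N)\in\mathbb{R}^{N\times d}$ (with $x_k\in\mathbb{R}^d$) put $\|x\|_N^2:=\sum_{k=1}^N\|x_k\|^2$, where $\|\cdot\|$ is the Euclidean norm on $\mathbb{R}^d$. The vector $\bar\psi\in\mathbb{R}^d$ is identified with $(\bar\psi,\dots,\bar\psi)\in\mathbb{R}^{N\times d}$ when it appears inside $\|\cdot\|_N$. Dynamics: for controls $u=(u^0,\dots,u^{M-1})$, $u^i=(u^i_1,\dots,u^i_N)\in\mathbb{R}^{N\times d}$, and initial state $\psi^0$, the states $\psi^i=(\psi^i_1,\dots,\psi^i_N)\in\mathbb{R}^{N\times d}$ are defined by $$\psi_k^{i+1}=\psi_k^i+h\Big(\frac1N\sum_{l=1}^N P(\psi_k^i,\psi_l^i)(\psi_l^i-\psi_k^i)+u_k^i\Big),\quad i=0,\dots,M-1,\ k=1,\dots,N .$$ Problem $Q(t_0,T,h,N,\psi^0)$, where $M=(T-t_0)/h\in\mathbb{N}$: minimize over $u$ the cost $$J_N^{(h,t_0,T)}(\psi,u)=\sum_{i=0}^{M-1}\frac hN\left(\|\psi^i-\bar\psi\|_N^2+\gamma\|u^i\|_N^2\right)$$ subject to the dynamics. An optimal state-control pair is a minimizing $u$ together with its associated states $\psi$. $(\psi^{(\sigma)},u^{(\sigma)})\in\mathbb{R}^{N\times d}\times\mathbb{R}^{N\times d}$ denotes the optimal solution of the static problem: minimize $\frac1N(\|\psi^{(\sigma)}-\bar\psi\|_N^2+\gamma\|u^{(\sigma)}\|_N^2)$ subject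 to $\frac1N\sum_{l=1}^N\big(P(\psi_k^{(\sigma)},\psi_l^{(\sigma)})(\psi_l^{(\sigma)}-\psi_k^{(\sigma)})+u_k^{(\sigma)}\big)=0$ for $k=1,\dots,N$. It is given by $\psi^{(\sigma)}_k=\bar\psi$, $u^{(\sigma)}_k=0$ for all $k$. *)

theory Defs
  imports "HOL-Analysis.Analysis"
begin

text \<open>
  Elements of \<open>\<real>\<^sup>N\<^sup>\<times>\<^sup>d\<close> have type \<open>(real ^ 'd) ^ 'n\<close> with \<open>N = CARD('n)\<close> and \<open>d = CARD('d)\<close>;
  \<open>x $ k\<close> is the \<open>k\<close>-th agent. The library norm of this type is the norm called
  \<open>\<parallel>\<cdot>\<parallel>\<^sub>N\<close> in the mathematical text:
\<close>

lemma norm_N_power2: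
  fixes x :: "(real ^ 'd) ^ 'n"
  shows "(norm x)\<^sup>2 = (\<Sum>k\<in>UNIV. (norm (x $ k))\<^sup>2)"
  by (simp add: norm_vec_def L2_set_def sum_nonneg)

definition diag :: "real ^ 'd \<Rightarrow> (real ^ 'd) ^ 'n" where
  "diag v = (\<chi> k. v)"

definition continuously_differentiable ::
    "('a::real_normed_vector \<Rightarrow> 'b::real_normed_vector) \<Rightarrow> bool" where
  "continuously_differentiable f \<longleftrightarrow>
     (\<exists>f' :: 'a \<Rightarrow> 'a \<Rightarrow>\<^sub>L 'b.
        (\<forall>x. (f has_derivative blinfun_apply (f' x)) (at x)) \<and> continuous_on UNIV f')"

text \<open>
  The dynamic problem depends on \<open>t\<^sub>0\<close> and \<open>T\<close> only through \<open>M = (T - t\<^sub>0) / h\<close>.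
  Trajectories and controls are functions on all of \<open>nat\<close>, but only the values \<open>\<psi> 0, \<dots>, \<psi> M\<close>
  and \<open>u 0, \<dots>, u (M - 1)\<close> are constrained or enter the cost.
\<close>

definition dynamics ::
    "((real ^ 'd) \<times> (real ^ 'd) \<Rightarrow> real) \<Rightarrow> real \<Rightarrow> nat \<Rightarrow> (real ^ 'd) ^ 'n \<Rightarrow>
     (nat \<Rightarrow> (real ^ 'd) ^ 'n) \<Rightarrow> (nat \<Rightarrow> (real ^ 'd) ^ 'n) \<Rightarrow> bool" where
  "dynamics P h M \<psi>0 \<psi> u \<longleftrightarrow>
     \<psi> 0 = \<psi>0 \<and>
     (\<forall>i<M. \<forall>k. \<psi> (Suc i) $ k =
        \<psi> i $ k + h *\<^sub>R ((1 / real CARD('n)) *\<^sub>R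
            (\<Sum>l\<in>UNIV. P (\<psi> i $ k, \<psi> i $ l) *\<^sub>R (\<psi> i $ l - \<psi> i $ k)) + u i $ k))"

definition cost ::
    "real \<Rightarrow> real ^ 'd \<Rightarrow> real \<Rightarrow> nat \<Rightarrow>
     (nat \<Rightarrow> (real ^ 'd) ^ 'n) \<Rightarrow> (nat \<Rightarrow> (real ^ 'd) ^ 'n) \<Rightarrow> real" where
  "cost \<gamma> \<psi>bar h M \<psi> u =
     (\<Sum>i<M. h / real CARD('n) * ((norm (\<psi> i - diag \<psi>bar))\<^sup>2 + \<gamma> * (norm (u i))\<^sup>2))"

definition optimal_pair ::
    "((real ^ 'd) \<times> (real ^ 'd) \<Rightarrow> real) \<Rightarrow> real \<Rightarrow> real ^ 'd \<Rightarrow> real \<Rightarrow> nat \<Rightarrow> (real ^ 'd) ^ 'n \<Rightarrow>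
     (nat \<Rightarrow> (real ^ 'd) ^ 'n) \<Rightarrow> (nat \<Rightarrow> (real ^ 'd) ^ 'n) \<Rightarrow> bool" where
  "optimal_pair P \<gamma> \<psi>bar h M \<psi>0 \<psi> u \<longleftrightarrow>
     dynamics P h M \<psi>0 \<psi> u \<and>
     (\<forall>\<psi>' u'. dynamics P h M \<psi>0 \<psi>' u' \<longrightarrow> cost \<gamma> \<psi>bar h M \<psi> u \<le> cost \<gamma> \<psi>bar h M \<psi>' u')"

definition static_feasible ::
    "((real ^ 'd) \<times> (real ^ 'd) \<Rightarrow> real) \<Rightarrow> (real ^ 'd) ^ 'n \<Rightarrow> (real ^ 'd) ^ 'n \<Rightarrow> bool" where
  "static_feasible P \<psi> u \<longleftrightarrow>
     (\<forall>k. (1 / real CARD('n)) *\<^sub>R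
        (\<Sum>l\<in>UNIV. P (\<psi> $ k, \<psi> $ l) *\<^sub>R (\<psi> $ l - \<psi> $ k) + u $ k) = 0)"

definition static_cost ::
    "real \<Rightarrow> real ^ 'd \<Rightarrow> (real ^ 'd) ^ 'n \<Rightarrow> (real ^ 'd) ^ 'n \<Rightarrow> real" where
  "static_cost \<gamma> \<psi>bar \<psi> u =
     1 / real CARD('n) * ((norm (\<psi> - diag \<psi>bar))\<^sup>2 + \<gamma> * (norm u)\<^sup>2)"

definition static_optimal ::
    "((real ^ 'd) \<times> (real ^ 'd) \<Rightarrow> real) \<Rightarrow> real \<Rightarrow> real ^ 'd \<Rightarrow>
     (real ^ 'd) ^ 'n \<Rightarrow> (real ^ 'd) ^ 'n \<Rightarrow> bool" where
  "static_optimal P \<gamma> \<psi>bar \<psi> u \<longleftrightarrow>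
     static_feasible P \<psi> u \<and>
     (\<forall>\<psi>' u' :: (real ^ 'd) ^ 'n.
        static_feasible P \<psi>' u' \<longrightarrow> static_cost \<gamma> \<psi>bar \<psi> u \<le> static_cost \<gamma> \<psi>bar \<psi>' u')"

text \<open>The static problem has exactly one solution, so one may speak of \<^emph>\<open>the\<close> static optimum.\<close>

lemma static_optimal_iff:
  fixes \<gamma> :: real and \<psi> u :: "(real ^ 'd) ^ 'n"
  assumes "\<gamma> > 0"
  shows "static_optimal P \<gamma> \<psi>bar \<psi> u \<longleftrightarrow> \<psi> = diag \<psi>bar \<and> u = 0"
proof -
  have feas: "static_feasible P (diag \<psi>bar) (0 :: (real ^ 'd) ^ 'n)"
    by (simp add: static_feasible_def diag_def)
  have zero: "static_cost \<gamma> \<psi>bar (diag \<psi>bar) (0 :: (real ^ 'd) ^ 'n) = 0"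
    by (simp add: static_cost_def)
  have nonneg: "static_cost \<gamma> \<psi>bar \<psi>' u' \<ge> 0" for \<psi>' u' :: "(real ^ 'd) ^ 'n"
    using assms by (simp add: static_cost_def)
  show ?thesis
  proof
    assume "static_optimal P \<gamma> \<psi>bar \<psi> u"
    with feas zero have "static_cost \<gamma> \<psi>bar \<psi> u \<le> 0"
      unfolding static_optimal_def by metis
    then have "(norm (\<psi> - diag \<psi>bar))\<^sup>2 + \<gamma> * (norm u)\<^sup>2 \<le> 0"
      by (simp add: static_cost_def divide_le_0_iff)
    moreover have "\<gamma> * (norm u)\<^sup>2 \<ge> 0" using assms by simp
    ultimately have "(norm (\<psi> - diag \<psi>bar))\<^sup>2 = 0" "\<gamma> * (norm u)\<^sup>2 = 0"
      using zero_le_power2[of "norm (\<psi> - diag \<psi>bar)"] by linarith+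
    then show "\<psi> = diag \<psi>bar \<and> u = 0" using assms by simp
  next
    assume "\<psi> = diag \<psi>bar \<and> u = 0"
    then show "static_optimal P \<gamma> \<psi>bar \<psi> u"
      using feas zero nonneg unfolding static_optimal_def by auto
  qed
qed

end

(* One application of an affine control moves any initial state exactly to the static state, where
   the zero control keeps it at zero running cost. The optimal cost is therefore bounded uniformly
   in the horizon, and the running cost dominates the square of the distance to the static pair. *)
theory Submission
  imports Defs
begin

text \<open>This is one step of \<open>dynamics\<close> solved for the control when every agent is
  to land on \<open>\<psi>bar\<close>. The division by \<open>h\<close> makes the resulting constant
  depend on the step size.\<close>

definition deadbeat_control ::
    "((real ^ 'd) \<times> (real ^ 'd) \<Rightarrow> real) \<Rightarrow> real \<Rightarrow> real ^ 'd \<Rightarrow> (real ^ 'd) ^ 'n \<Rightarrow>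
     (real ^ 'd) ^ 'n" where
  "deadbeat_control P h \<psi>bar \<psi>0 =
     (\<chi> k. (1 / h) *\<^sub>R (\<psi>bar - \<psi>0 $ k) - (1 / real CARD('n)) *\<^sub>R
            (\<Sum>l\<in>UNIV. P (\<psi>0 $ k, \<psi>0 $ l) *\<^sub>R (\<psi>0 $ l - \<psi>0 $ k)))"

text \<open>From time 1 on all agents coincide, so every difference in the interaction term vanishes
  and zero control keeps them in place.\<close>

lemma dynamics_deadbeat:
  fixes \<psi>0 :: "(real ^ 'd) ^ 'n"
  assumes "h \<noteq> 0"
  shows "dynamics P h M \<psi>0
           (\<lambda>i. if i = 0 then \<psi>0 else diag \<psi>bar)
           (\<lambda>i. if i = 0 then deadbeat_control P h \<psi>bar \<psi>0 else 0)"
  using assms by (auto simp: dynamics_def deadbeat_control_def diag_def)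

lemma cost_deadbeat:
  fixes \<psi>0 v :: "(real ^ 'd) ^ 'n"
  assumes "M > 0"
  shows "cost \<gamma> \<psi>bar h M
           (\<lambda>i. if i = 0 then \<psi>0 else diag \<psi>bar) (\<lambda>i. if i = 0 then v else 0)
         = h / real CARD('n) * ((norm (\<psi>0 - diag \<psi>bar))\<^sup>2 + \<gamma> * (norm v)\<^sup>2)"
proof -
  obtain m where "M = Suc m"
    using assms gr0_implies_Suc by blast
  then show ?thesis
    \<comment> \<open>The term at time 0 has to be split off, whereas the default rule splits off
      the last one. All later terms are zero.\<close>
    by (simp add: cost_def sum.lessThan_Suc_shift del: sum.lessThan_Suc)
qed

text \<open>The deadbeat pair is an admissible competitor, and its cost is the same for every
  positive \<open>M\<close>.\<close>

lemma optimal_cost_le: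
  fixes \<psi>0 :: "(real ^ 'd) ^ 'n"
  assumes "optimal_pair P \<gamma> \<psi>bar h M \<psi>0 \<psi> u" and "h \<noteq> 0" and "M > 0"
  shows "cost \<gamma> \<psi>bar h M \<psi> u \<le> h / real CARD('n) *
           ((norm (\<psi>0 - diag \<psi>bar))\<^sup>2 + \<gamma> * (norm (deadbeat_control P h \<psi>bar \<psi>0))\<^sup>2)"
  using assms(1) dynamics_deadbeat[OF assms(2), of P M \<psi>0 \<psi>bar]
  unfolding optimal_pair_def cost_deadbeat[OF assms(3), symmetric] by blast

text \<open>Combines \<open>2 * a * b \<le> a\<^sup>2 + b\<^sup>2\<close> with the fact that
  \<open>min 1 \<gamma>\<close> lies below both weights 1 and \<open>\<gamma>\<close>.\<close>

lemma square_sum_le_weighted: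
  fixes a b \<gamma> :: real
  assumes "\<gamma> > 0"
  shows "(a + b)\<^sup>2 \<le> 2 / min 1 \<gamma> * (a\<^sup>2 + \<gamma> * b\<^sup>2)"
proof -
  have "min 1 \<gamma> * (a + b)\<^sup>2 \<le> min 1 \<gamma> * (2 * (a\<^sup>2 + b\<^sup>2))"
    using assms sum_squares_bound[of a b] by (intro mult_left_mono) (auto simp: power2_sum)
  also have "\<dots> = 2 * (min 1 \<gamma> * a\<^sup>2 + min 1 \<gamma> * b\<^sup>2)"
    by (simp add: algebra_simps)
  also have "\<dots> \<le> 2 * (1 * a\<^sup>2 + \<gamma> * b\<^sup>2)"
    by (intro mult_left_mono add_mono mult_right_mono) auto
  finally show ?thesis
    using assms by (simp add: field_simps)
qed

lemma sum_square_le_cost: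
  fixes \<psi> u :: "nat \<Rightarrow> (real ^ 'd) ^ 'n"
  assumes "\<gamma> > 0" and "h > 0"
  shows "(\<Sum>i=m..<M. h * (norm (\<psi> i - diag \<psi>bar) + norm (u i))\<^sup>2)
         \<le> 2 * real CARD('n) / min 1 \<gamma> * cost \<gamma> \<psi>bar h M \<psi> u"
proof -
  have "(\<Sum>i=m..<M. h * (norm (\<psi> i - diag \<psi>bar) + norm (u i))\<^sup>2)
        \<le> (\<Sum>i<M. h * (norm (\<psi> i - diag \<psi>bar) + norm (u i))\<^sup>2)"
    \<comment> \<open>All terms are nonnegative, so any starting index \<open>m\<close> is
      allowed.\<close>
    using assms by (intro sum_mono2) auto
  also have "\<dots> \<le> (\<Sum>i<M. h * (2 / min 1 \<gamma> *
      ((norm (\<psi> i - diag \<psi>bar))\<^sup>2 + \<gamma> * (norm (u i))\<^sup>2)))"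
    using assms by (intro sum_mono mult_left_mono square_sum_le_weighted) auto
  \<comment> \<open>The factor \<open>real CARD('n)\<close> cancels the averaging in
    \<open>cost\<close>.\<close>
  also have "\<dots> = 2 * real CARD('n) / min 1 \<gamma> * cost \<gamma> \<psi>bar h M \<psi> u"
    by (simp add: cost_def sum_distrib_left mult_ac)
  finally show ?thesis .
qed

theorem theorem2p2:
  fixes P :: "(real ^ 'd) \<times> (real ^ 'd) \<Rightarrow> real"
    and \<gamma> h t0 :: real
    and \<psi>bar :: "real ^ 'd"
    and \<psi>0 \<psi>\<sigma> u\<sigma> :: "(real ^ 'd) ^ 'n"
  assumes "\<gamma> > 0" and "h > 0"
    and "continuously_differentiable P"
    and "P (0, 0) = 0"
    and "bdd_above (range (\<lambda>z. \<bar>P z\<bar>))"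
    and "static_optimal P \<gamma> \<psi>bar \<psi>\<sigma> u\<sigma>"
  shows "\<exists>C1 lam (\<alpha> :: real \<Rightarrow> real).
    C1 > 0 \<and> 0 < lam \<and> lam < 1 \<and>
    \<alpha> \<in> {0..} \<rightarrow> {0..} \<and> strict_mono_on {0..} \<alpha> \<and> \<alpha> 0 = 0 \<and>
    (\<forall>T M \<psi> u. T > t0 \<and> M > 0 \<and> (T - t0) / h = real M \<and>
       optimal_pair P \<gamma> \<psi>bar h M \<psi>0 \<psi> u \<longrightarrow>
       (\<Sum>i = nat \<lfloor>(1 - lam) * real M\<rfloor>..<M.
          h * \<alpha> (norm (\<psi> i - \<psi>\<sigma>) + norm (u i - u\<sigma>))) \<le> C1)"
proof -
  define C where "C = h / real CARD('n) *
    ((norm (\<psi>0 - diag \<psi>bar))\<^sup>2 + \<gamma> * (norm (deadbeat_control P h \<psi>bar \<psi>0))\<^sup>2)"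
  define K where "K = 2 * real CARD('n) / min 1 \<gamma>"
  have "C \<ge> 0" and "K \<ge> 0"
    using assms(1,2) by (simp_all add: C_def K_def)
  have static: "\<psi>\<sigma> = diag \<psi>bar" "u\<sigma> = 0"
    using assms static_optimal_iff by blast+
  \<comment> \<open>The summand 1 keeps the constant strictly positive: \<open>C\<close> is 0 if
    \<open>\<psi>0\<close> already is the static state.\<close>
  have "(\<Sum>i=m..<M. h * (norm (\<psi> i - \<psi>\<sigma>) + norm (u i - u\<sigma>))\<^sup>2) \<le> K * C + 1"
    if "M > 0" "optimal_pair P \<gamma> \<psi>bar h M \<psi>0 \<psi> u" for m M \<psi> u
  proof -
    have "(\<Sum>i=m..<M. h * (norm (\<psi> i - \<psi>\<sigma>) + norm (u i - u\<sigma>))\<^sup>2)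
          \<le> K * cost \<gamma> \<psi>bar h M \<psi> u"
      using sum_square_le_cost[OF assms(1,2)] by (simp add: static K_def)
    also have "\<dots> \<le> K * C"
      using optimal_cost_le[OF that(2)] that(1) assms(2) \<open>K \<ge> 0\<close>
      by (intro mult_left_mono) (auto simp: C_def)
    finally show ?thesis by simp
  qed
  moreover have "strict_mono_on {0..} (\<lambda>s::real. s\<^sup>2)"
    by (auto intro!: strict_mono_onI power_strict_mono)
  moreover have "K * C + 1 > 0"
    using mult_nonneg_nonneg[OF \<open>K \<ge> 0\<close> \<open>C \<ge> 0\<close>] by linarith
  ultimately show ?thesis
    \<comment> \<open>Since the bound holds for every \<open>m\<close>, any number strictly between
      0 and 1 could replace \<open>1 / 2\<close>.\<close>
    by (intro exI[of _ "K * C + 1"] exI[of _ "1 / 2"] exI[of _ "\<lambda>s. s\<^sup>2"]) auto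
qed

end
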